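(* Let $0\le l\le 1/4$ and $0\le\epsilon\le1$. Let $\mathbf{S}^l_{(\epsilon,\epsilon)}$ be the set of local hidden variable behaviors over binary random variables $X,Y,A,B$ with relaxed measurement dependence parameter $l$ and relaxed parameter dependence parameters $\xi^{\mathbf A\to\mathbf B}=\xi^{\mathbf B\to\mathbf A}=\epsilon$. Then $\mathbf{S}^l_{(\epsilon,\epsilon)}\subseteq\mathbf{S}_{(\kappa,\kappa)}$ with $$\kappa=\epsilon+(1-\epsilon)\frac{1-4l}{1-2l}.$$
   Context: A behavior is a family of conditional probabilities $\mathrm{p}(a,b|x,y)$, $a,b,x,y\in\{0,1\}$, nonnegative and normalized over $(a,b)$ for each $(x,y)$. Hidden variables are discrete. The inputs are uniformly distributed: $\mathrm{p}(x,y)=1/4$ for all $x,y$. The set $\mathbf{S}_{(\epsilon^{\mathbf A\to\mathbf B},\epsilon^{\mathbf B\to\mathbf A})}$: the set of behaviors of the form $\mathrm{p}(a,b|x,y)=\sum_\lambda\mathrm{p}(\lambda)\,\mathrm{p}(a|x,y,\lambda)\,\mathrm{p}(b|x,y,\lambda)$ satisfying $$\Big|\sum_a\mathrm{p}(a,b|x,y)-\sum_a\mathrm{p}(a,b|x',y)\Big|\le\epsilon^{\mathbf A\to\mathbf B}\quad\text{and}\quad\Big|\sum_b\mathrm{p}(a,b|x,y)-\sum_b\mathrm{p}(a,b|x,y')\Big|\le\epsilon^{\mathbf B\to\mathbf A}$$ for all $a,b,x,y,x',y'\in\{0,1\}$. The set $\mathbf{S}^l_{(\xi^{\mathbf A\to\mathbf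 B},\xi^{\mathbf B\to\mathbf A})}$: the set of behaviors of the form $\mathrm{p}(a,b|x,y)=\sum_\lambda\mathrm{p}(\lambda|x,y)\,\mathrm{p}(a|x,y,\lambda)\,\mathrm{p}(b|x,y,\lambda)$, where $\mathrm{p}(\lambda|x,y)=\mathrm{p}(\lambda)\,\mathrm{p}(x,y|\lambda)/\mathrm{p}(x,y)$ with $\mathrm{p}(\lambda)$ a distribution, $\mathrm{p}(x,y|\lambda)$ conditional distributions on $\{0,1\}^2$ with $\mathrm{p}(x,y|\lambda)\ge l$ for all $x,y,\lambda$, and $\sum_\lambda\mathrm{p}(\lambda)\mathrm{p}(x,y|\lambda)=\mathrm{p}(x,y)=1/4$, and where $$|\mathrm{p}(b|x,y,\lambda)-\mathrm{p}(b|x',y,\lambda)|\le\xi^{\mathbf A\to\mathbf B}\quad\text{and}\quad|\mathrm{p}(a|x,y,\lambda)-\mathrm{p}(a|x,y',\lambda)|\le\xi^{\mathbf B\to\mathbf A}$$ for all $\lambda,a,b,x,y,x',y'$. *)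

theory Defs
  imports "HOL-Probability.Probability"
begin

text \<open>
  The alphabet \<open>{0,1}\<close> of inputs and outputs is represented by \<^typ>\<open>bool\<close>.
  A family \<open>p a b x y\<close> stands for $p(a,b|x,y)$.
\<close>

type_synonym family = "bool \<Rightarrow> bool \<Rightarrow> bool \<Rightarrow> bool \<Rightarrow> real"

definition behavior :: "family \<Rightarrow> bool" where
  "behavior p \<longleftrightarrow>
     (\<forall>a b x y. 0 \<le> p a b x y) \<and>
     (\<forall>x y. (\<Sum>a\<in>UNIV. \<Sum>b\<in>UNIV. p a b x y) = 1)"

definition input_dist :: "(bool \<times> bool) pmf" where
  "input_dist = pmf_of_set UNIV"

lemma pmf_input_dist [simp]: "pmf input_dist xy = 1 / 4"
  by (simp add: input_dist_def)

text \<open>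
  A discrete hidden variable takes at most countably many values, so it is taken to be
  \<^typ>\<open>nat\<close>-valued. Smaller ranges are covered by giving the surplus values probability 0,
  uniform inputs and constant responses, which meet all bounds when \<open>l \<le> 1/4\<close> and \<open>\<xi>AB, \<xi>BA \<ge> 0\<close>.
  Response distributions are written \<open>PA x y h\<close> for $p(\cdot|x,y,h)$ on Alice's outputs, and
  \<open>PB x y h\<close> on Bob's; both may depend on both inputs.
\<close>

definition S_signaling :: "real \<Rightarrow> real \<Rightarrow> family set" where
  "S_signaling \<epsilon>AB \<epsilon>BA = {p. behavior p \<and>
     (\<exists>(\<mu> :: nat pmf) (PA :: bool \<Rightarrow> bool \<Rightarrow> nat \<Rightarrow> bool pmf) (PB :: bool \<Rightarrow> bool \<Rightarrow> nat \<Rightarrow> bool pmf).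
        \<forall>a b x y. p a b x y = (\<Sum>\<^sub>\<infinity>h. pmf \<mu> h * pmf (PA x y h) a * pmf (PB x y h) b)) \<and>
     (\<forall>b x x' y. \<bar>(\<Sum>a\<in>UNIV. p a b x y) - (\<Sum>a\<in>UNIV. p a b x' y)\<bar> \<le> \<epsilon>AB) \<and>
     (\<forall>a x y y'. \<bar>(\<Sum>b\<in>UNIV. p a b x y) - (\<Sum>b\<in>UNIV. p a b x y')\<bar> \<le> \<epsilon>BA)}"

text \<open>
  \<open>Q h\<close> is the distribution $p(\cdot,\cdot|h)$ of the input pair given the hidden value.
\<close>

definition hidden_given_inputs ::
    "nat pmf \<Rightarrow> (nat \<Rightarrow> (bool \<times> bool) pmf) \<Rightarrow> bool \<Rightarrow> bool \<Rightarrow> nat \<Rightarrow> real" where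
  "hidden_given_inputs \<mu> Q x y h = pmf \<mu> h * pmf (Q h) (x, y) / pmf input_dist (x, y)"

definition S_relaxed :: "real \<Rightarrow> real \<Rightarrow> real \<Rightarrow> family set" where
  "S_relaxed l \<xi>AB \<xi>BA = {p. behavior p \<and>
     (\<exists>(\<mu> :: nat pmf) (Q :: nat \<Rightarrow> (bool \<times> bool) pmf)
        (PA :: bool \<Rightarrow> bool \<Rightarrow> nat \<Rightarrow> bool pmf) (PB :: bool \<Rightarrow> bool \<Rightarrow> nat \<Rightarrow> bool pmf).
        (\<forall>a b x y. p a b x y =
           (\<Sum>\<^sub>\<infinity>h. hidden_given_inputs \<mu> Q x y h * pmf (PA x y h) a * pmf (PB x y h) b)) \<and>
        (\<forall>x y h. l \<le> pmf (Q h) (x, y)) \<and>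
        (\<forall>x y. (\<Sum>\<^sub>\<infinity>h. pmf \<mu> h * pmf (Q h) (x, y)) = pmf input_dist (x, y)) \<and>
        (\<forall>b x x' y h. \<bar>pmf (PB x y h) b - pmf (PB x' y h) b\<bar> \<le> \<xi>AB) \<and>
        (\<forall>a x y y' h. \<bar>pmf (PA x y h) a - pmf (PA x y' h) a\<bar> \<le> \<xi>BA))}"

end

theory Submission
  imports Defs
begin

text \<open>
  Take deterministic responses to a hidden table that lists, for each input pair, an output pair
  drawn independently from \<open>p(\<cdot>,\<cdot>|x,y)\<close>. Thus every behavior has the required hidden variable form,
  and only the signaling bounds need work.

  For two distinct input pairs let \<open>u, v\<close> be their probabilities given the hidden value, and \<open>s, t\<close>
  the corresponding response probabilities. Comparing on the common part \<open>min u v\<close> gives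
  \<open>u s - v t \<le> u - (1 - \<epsilon>) min u v\<close>. Since \<open>u + v \<le> 1 - 2 l\<close>, we have
  \<open>min u v \<ge> l \<ge> (u + v) l / (1 - 2 l)\<close>, and the resulting bound is linear in \<open>u, v\<close>, hence can be
  averaged over the hidden variable.
\<close>

lemma behavior_hidden_variable_form:
  assumes "behavior p"
  obtains \<mu> :: "nat pmf" and PA PB :: "bool \<Rightarrow> bool \<Rightarrow> nat \<Rightarrow> bool pmf" where
    "\<And>a b x y. p a b x y = (\<Sum>\<^sub>\<infinity>h. pmf \<mu> h * pmf (PA x y h) a * pmf (PB x y h) b)"
proof -
  define D where "D xy = embed_pmf (\<lambda>(a, b). p a b (fst xy) (snd xy))" for xy :: "bool \<times> bool"
  have pmf_D: "pmf (D (x, y)) (a, b) = p a b x y" for a b x y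
  proof -
    have "(\<Sum>ab\<in>UNIV. (case ab of (a, b) \<Rightarrow> p a b x y)) = 1"
      using assms unfolding behavior_def UNIV_Times_UNIV[symmetric]
      by (subst sum.cartesian_product[symmetric]) auto
    moreover have nonneg: "0 \<le> (case ab of (a, b) \<Rightarrow> p a b x y)" for ab
      using assms by (auto simp: behavior_def split: prod.split)
    ultimately have "(\<integral>\<^sup>+ ab. ennreal (case ab of (a, b) \<Rightarrow> p a b x y) \<partial>count_space UNIV) = 1"
      by (subst nn_integral_count_space_finite) (auto simp: sum_ennreal)
    with nonneg show ?thesis
      unfolding D_def by (subst pmf_embed_pmf) auto
  qed
  \<comment> \<open>A random table with independent entries, the one at \<open>xy\<close>
    distributed as \<open>D xy\<close>. With index set \<open>UNIV\<close> every entry is drawn, so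
    the default \<open>undefined\<close> never fills one. There are finitely many tables, so
    \<open>to_nat\<close> encodes them injectively.\<close>
  define F where "F = Pi_pmf UNIV undefined D"
  define \<mu> where "\<mu> = map_pmf to_nat F"
  define f where "f h = (from_nat h :: bool \<times> bool \<Rightarrow> bool \<times> bool)" for h
  have "p a b x y = (\<Sum>\<^sub>\<infinity>h. pmf \<mu> h * pmf (return_pmf (fst (f h (x, y)))) a
                             * pmf (return_pmf (snd (f h (x, y)))) b)" for a b x y
  proof -
    let ?A = "{h. f h (x, y) = (a, b)}"
    have "map_pmf (\<lambda>h. f h (x, y)) \<mu> = D (x, y)"
      by (simp add: \<mu>_def f_def F_def pmf.map_comp o_def Pi_pmf_component)
    then have "p a b x y = pmf (map_pmf (\<lambda>h. f h (x, y)) \<mu>) (a, b)"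
      by (simp add: pmf_D)
    also have "\<dots> = measure \<mu> ?A"
      by (simp add: pmf_map vimage_def)
    also have "\<dots> = infsetsum (pmf \<mu>) ?A"
      by (rule measure_pmf_conv_infsetsum)
    also have "\<dots> = infsum (pmf \<mu>) ?A"
      by (rule infsetsum_infsum) (rule pmf_abs_summable)
    \<comment> \<open>The two point masses multiply to the indicator of \<open>?A\<close>, so the
      terms outside \<open>?A\<close> vanish.\<close>
    also have "\<dots> = (\<Sum>\<^sub>\<infinity>h. pmf \<mu> h * pmf (return_pmf (fst (f h (x, y)))) a
                             * pmf (return_pmf (snd (f h (x, y)))) b)"
      by (rule infsum_cong_neutral) (auto simp: indicator_def prod_eq_iff)
    finally show ?thesis .
  qed
  then show thesis
    by (intro that)
qed

text \<open>Four input pairs share total probability 1, and the two other than \<open>i\<close> and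
  \<open>j\<close> take at least \<open>l\<close> each.\<close>

lemma pmf_bool_pair_add_le:
  fixes q :: "(bool \<times> bool) pmf"
  assumes "\<And>k. l \<le> pmf q k" and "i \<noteq> j"
  shows "pmf q i + pmf q j \<le> 1 - 2 * l"
proof -
  have "1 = (\<Sum>k\<in>UNIV. pmf q k)"
    by (simp add: sum_pmf_eq_1)
  also have "\<dots> = (\<Sum>k\<in>UNIV - {i, j}. pmf q k) + (\<Sum>k\<in>{i, j}. pmf q k)"
    by (rule sum.subset_diff) auto
  finally have "1 = (\<Sum>k\<in>UNIV - {i, j}. pmf q k) + (pmf q i + pmf q j)"
    using assms(2) by simp
  moreover have "card (UNIV - {i, j}) = 2"
    using assms(2) by (simp add: card_Diff_subset card_UNIV_bool)
  then have "2 * l \<le> (\<Sum>k\<in>UNIV - {i, j}. pmf q k)"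
    using sum_mono[of "UNIV - {i, j}" "\<lambda>_. l" "pmf q"] assms(1) by simp
  ultimately show ?thesis
    by linarith
qed

lemma weighted_response_diff_le:
  fixes l \<epsilon> u v s t :: real
  assumes "0 \<le> l" "l \<le> 1 / 4" "\<epsilon> \<le> 1"
    and "l \<le> u" "l \<le> v" "u + v \<le> 1 - 2 * l"
    and "s \<le> 1" "0 \<le> t" "\<bar>s - t\<bar> \<le> \<epsilon>"
  shows "u * s - v * t \<le> u - (1 - \<epsilon>) * (l / (1 - 2 * l)) * (u + v)"
proof -
  have "l * (u + v) \<le> l * (1 - 2 * l)"
    using assms by (intro mult_left_mono) auto
  \<comment> \<open>The bound \<open>l \<le> 1 / 4\<close> makes \<open>1 - 2 * l\<close> positive,
    so dividing by it preserves the order.\<close>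
  then have "l / (1 - 2 * l) * (u + v) \<le> l"
    using assms by (simp add: field_simps)
  then have "l / (1 - 2 * l) * (u + v) \<le> min u v"
    using assms by linarith
  then have "(1 - \<epsilon>) * (l / (1 - 2 * l) * (u + v)) \<le> (1 - \<epsilon>) * min u v"
    using assms by (intro mult_left_mono) auto
  moreover have "u * s - v * t \<le> u - (1 - \<epsilon>) * min u v"
  proof (cases "u \<le> v")
    case True
    \<comment> \<open>Split \<open>u * s - v * t\<close> as
      \<open>u * (s - t) + (u * t - v * t)\<close>, whose second part is at most 0.\<close>
    have "u * (s - t) \<le> u * \<epsilon>" "u * t \<le> v * t"
      using assms True by (auto intro!: mult_left_mono mult_right_mono)
    with True show ?thesis
      by (simp add: algebra_simps)
  next
    case False
    \<comment> \<open>Here the split is \<open>v * (s - t) + (u - v) * s\<close>: the excess weight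
      \<open>u - v\<close> is charged in full.\<close>
    have "v * (s - t) \<le> v * \<epsilon>" "(u - v) * s \<le> (u - v) * 1"
      using assms False by (intro mult_left_mono; simp)+
    with False show ?thesis
      by (simp add: algebra_simps)
  qed
  ultimately show ?thesis
    by (simp add: mult.assoc)
qed

lemma summable_on_mult_unit:
  fixes w s :: "'a \<Rightarrow> real"
  assumes "w summable_on A" "\<And>h. 0 \<le> w h" "\<And>h. 0 \<le> s h" "\<And>h. s h \<le> 1"
  shows "(\<lambda>h. w h * s h) summable_on A"
  using assms by (intro summable_on_comparison_test[OF assms(1)]) (auto intro: mult_left_le)

context
  fixes \<mu> :: "nat pmf" and Q :: "nat \<Rightarrow> (bool \<times> bool) pmf"
begin

lemma hidden_given_inputs_nonneg: "0 \<le> hidden_given_inputs \<mu> Q x y h"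
  by (simp add: hidden_given_inputs_def)

lemma summable_hidden_given_inputs: "hidden_given_inputs \<mu> Q x y summable_on UNIV"
proof -
  have "pmf \<mu> summable_on UNIV"
    by (rule abs_summable_summable[OF abs_summable_equivalent[THEN iffD2, OF pmf_abs_summable]])
  \<comment> \<open>The factor 4 is the reciprocal of the uniform input probability.\<close>
  then have "(\<lambda>h. pmf \<mu> h * pmf (Q h) (x, y) * 4) summable_on UNIV"
    by (intro summable_on_cmult_left summable_on_mult_unit) (auto simp: pmf_le_1)
  then show ?thesis
    by (simp add: hidden_given_inputs_def [abs_def])
qed

text \<open>By Bayes' rule, averaging \<open>Q\<close> to the prescribed input distribution is what
  normalizes the weights over the hidden values.\<close>

lemma infsum_hidden_given_inputs:
  assumes "(\<Sum>\<^sub>\<infinity>h. pmf \<mu> h * pmf (Q h) (x, y)) = pmf input_dist (x, y)"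
  shows "(\<Sum>\<^sub>\<infinity>h. hidden_given_inputs \<mu> Q x y h) = 1"
proof -
  have "(\<Sum>\<^sub>\<infinity>h. hidden_given_inputs \<mu> Q x y h) = (\<Sum>\<^sub>\<infinity>h. pmf \<mu> h * pmf (Q h) (x, y) * 4)"
    by (simp add: hidden_given_inputs_def)
  also have "\<dots> = (\<Sum>\<^sub>\<infinity>h. pmf \<mu> h * pmf (Q h) (x, y)) * 4"
    by (rule infsum_cmult_left')
  finally show ?thesis
    using assms by simp
qed

text \<open>Given the hidden value the outputs are independent, so one party's response
  probabilities sum to 1 and drop out. Summability permits exchanging the finite and the infinite
  sum.\<close>

lemma marginal_eq:
  fixes PA PB :: "nat \<Rightarrow> bool pmf"
  shows "(\<Sum>a\<in>UNIV. \<Sum>\<^sub>\<infinity>h. hidden_given_inputs \<mu> Q x y h * pmf (PA h) a * pmf (PB h) b)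
           = (\<Sum>\<^sub>\<infinity>h. hidden_given_inputs \<mu> Q x y h * pmf (PB h) b)"
    and "(\<Sum>b\<in>UNIV. \<Sum>\<^sub>\<infinity>h. hidden_given_inputs \<mu> Q x y h * pmf (PA h) a * pmf (PB h) b)
           = (\<Sum>\<^sub>\<infinity>h. hidden_given_inputs \<mu> Q x y h * pmf (PA h) a)"
proof -
  let ?w = "hidden_given_inputs \<mu> Q x y"
  have sm: "(\<lambda>h. ?w h * pmf (PA h) a * pmf (PB h) b) summable_on UNIV" for a b
    by (intro summable_on_mult_unit summable_hidden_given_inputs)
       (auto simp: hidden_given_inputs_nonneg pmf_le_1)
  have one: "pmf q True + pmf q False = 1" for q :: "bool pmf"
    using sum_pmf_eq_1[of UNIV q, OF finite subset_UNIV] by (simp add: UNIV_bool add.commute)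
  have "?w h * pmf (PA h) True * c + ?w h * pmf (PA h) False * c = ?w h * c" for h c
    using one[of "PA h"] by (metis distrib_left distrib_right mult.right_neutral)
  then show "(\<Sum>a\<in>UNIV. \<Sum>\<^sub>\<infinity>h. ?w h * pmf (PA h) a * pmf (PB h) b) = (\<Sum>\<^sub>\<infinity>h. ?w h * pmf (PB h) b)"
    by (simp add: UNIV_bool infsum_add[OF sm sm, symmetric] add.commute)
  have "?w h * c * pmf (PB h) True + ?w h * c * pmf (PB h) False = ?w h * c" for h c
    using one[of "PB h"] by (metis distrib_left mult.right_neutral)
  then show "(\<Sum>b\<in>UNIV. \<Sum>\<^sub>\<infinity>h. ?w h * pmf (PA h) a * pmf (PB h) b) = (\<Sum>\<^sub>\<infinity>h. ?w h * pmf (PA h) a)"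
    by (simp add: UNIV_bool infsum_add[OF sm sm, symmetric] add.commute)
qed

text \<open>The pointwise bound is linear in two weight functions that each sum to 1, so summing it
  over the hidden values leaves a constant.\<close>

lemma marginal_diff_le:
  fixes l \<epsilon> :: real
  assumes l: "0 \<le> l" "l \<le> 1 / 4" and \<epsilon>: "0 \<le> \<epsilon>" "\<epsilon> \<le> 1"
    and Q: "\<And>x y h. l \<le> pmf (Q h) (x, y)"
    and inputs: "\<And>x y. (\<Sum>\<^sub>\<infinity>h. pmf \<mu> h * pmf (Q h) (x, y)) = pmf input_dist (x, y)"
    and s: "\<And>h. 0 \<le> s h" "\<And>h. s h \<le> 1" and t: "\<And>h. 0 \<le> t h" "\<And>h. t h \<le> 1"
    and st: "\<And>h. \<bar>s h - t h\<bar> \<le> \<epsilon>" and ne: "(x, y) \<noteq> (x', y')"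
  shows "(\<Sum>\<^sub>\<infinity>h. hidden_given_inputs \<mu> Q x y h * s h)
           - (\<Sum>\<^sub>\<infinity>h. hidden_given_inputs \<mu> Q x' y' h * t h)
         \<le> \<epsilon> + (1 - \<epsilon>) * ((1 - 4 * l) / (1 - 2 * l))"
proof -
  let ?w = "hidden_given_inputs \<mu> Q x y" and ?w' = "hidden_given_inputs \<mu> Q x' y'"
  \<comment> \<open>The coefficient from \<open>weighted_response_diff_le\<close>, for which
    \<open>1 - 2 * K\<close> is the claimed bound.\<close>
  define K where "K = (1 - \<epsilon>) * (l / (1 - 2 * l))"
  note sw = summable_hidden_given_inputs[of x y] summable_hidden_given_inputs[of x' y']
  have sws: "(\<lambda>h. ?w h * s h) summable_on UNIV" and swt: "(\<lambda>h. ?w' h * t h) summable_on UNIV"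
    by (intro summable_on_mult_unit sw; simp add: hidden_given_inputs_nonneg s t)+
  have pointwise: "?w h * s h - ?w' h * t h \<le> ?w h - K * (?w h + ?w' h)" for h
  proof -
    have Ql: "l \<le> pmf (Q h) k" for k
      using Q by (cases k) auto
    have "pmf (Q h) (x, y) * s h - pmf (Q h) (x', y') * t h
        \<le> pmf (Q h) (x, y) - K * (pmf (Q h) (x, y) + pmf (Q h) (x', y'))"
      unfolding K_def
      by (rule weighted_response_diff_le)
         (use l \<epsilon> Q s t st pmf_bool_pair_add_le[OF Ql ne] in auto)
    \<comment> \<open>Multiplying by \<open>4 * pmf \<mu> h\<close> turns the probabilities of the
      input pairs given \<open>h\<close> into the weights \<open>?w h\<close> and
      \<open>?w' h\<close>.\<close>
    then have "4 * pmf \<mu> h * (pmf (Q h) (x, y) * s h - pmf (Q h) (x', y') * t h)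
        \<le> 4 * pmf \<mu> h * (pmf (Q h) (x, y) - K * (pmf (Q h) (x, y) + pmf (Q h) (x', y')))"
      by (rule mult_left_mono) simp
    then show ?thesis
      by (simp add: hidden_given_inputs_def algebra_simps)
  qed
  have "(?w has_sum 1) UNIV" "(?w' has_sum 1) UNIV"
    using sw infsum_hidden_given_inputs[OF inputs] by (metis has_sum_infsum)+
  \<comment> \<open>The subtracted term \<open>?w' h * t h\<close> is moved to the right, so that
    \<open>has_sum_mono\<close> can compare two convergent series term by term.\<close>
  then have bound: "((\<lambda>h. (1 - K) * ?w h + (- K) * ?w' h + ?w' h * t h) has_sum
      ((1 - K) * 1 + (- K) * 1 + (\<Sum>\<^sub>\<infinity>h. ?w' h * t h))) UNIV"
    by (intro has_sum_add has_sum_cmult_right has_sum_infsum swt)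
  have "(\<Sum>\<^sub>\<infinity>h. ?w h * s h) \<le> (1 - K) * 1 + (- K) * 1 + (\<Sum>\<^sub>\<infinity>h. ?w' h * t h)"
    using has_sum_infsum[OF sws] bound by (rule has_sum_mono) (use pointwise in \<open>simp add: algebra_simps\<close>)
  then have "(\<Sum>\<^sub>\<infinity>h. ?w h * s h) - (\<Sum>\<^sub>\<infinity>h. ?w' h * t h) \<le> 1 - 2 * K"
    by simp
  also have "\<dots> = \<epsilon> + (1 - \<epsilon>) * ((1 - 4 * l) / (1 - 2 * l))"
    using l by (simp add: K_def field_simps)
  finally show ?thesis .
qed

text \<open>Exchanging the input pairs gives the other sign of the difference. Equal pairs give
  difference 0, and the bound is nonnegative. The response \<open>r\<close> may be either
  party's.\<close>

lemma marginal_dist_le: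
  fixes l \<epsilon> :: real
  assumes l: "0 \<le> l" "l \<le> 1 / 4" and \<epsilon>: "0 \<le> \<epsilon>" "\<epsilon> \<le> 1"
    and Q: "\<And>x y h. l \<le> pmf (Q h) (x, y)"
    and inputs: "\<And>x y. (\<Sum>\<^sub>\<infinity>h. pmf \<mu> h * pmf (Q h) (x, y)) = pmf input_dist (x, y)"
    and r: "\<And>x y h. 0 \<le> r x y h" "\<And>x y h. r x y h \<le> 1"
    and close: "\<And>h. \<bar>r x y h - r x' y' h\<bar> \<le> \<epsilon>"
  shows "\<bar>(\<Sum>\<^sub>\<infinity>h. hidden_given_inputs \<mu> Q x y h * r x y h)
           - (\<Sum>\<^sub>\<infinity>h. hidden_given_inputs \<mu> Q x' y' h * r x' y' h)\<bar>
         \<le> \<epsilon> + (1 - \<epsilon>) * ((1 - 4 * l) / (1 - 2 * l))"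
proof (cases "(x, y) = (x', y')")
  case True
  then show ?thesis
    using l \<epsilon> by simp
next
  case False
  have close': "\<bar>r x' y' h - r x y h\<bar> \<le> \<epsilon>" for h
    using close[of h] by (simp add: abs_minus_commute)
  let ?m = "\<lambda>x y. \<Sum>\<^sub>\<infinity>h. hidden_given_inputs \<mu> Q x y h * r x y h"
  let ?\<kappa> = "\<epsilon> + (1 - \<epsilon>) * ((1 - 4 * l) / (1 - 2 * l))"
  have "?m x y - ?m x' y' \<le> ?\<kappa>"
    by (rule marginal_diff_le[OF l \<epsilon> Q inputs r r close False])
  moreover have "?m x' y' - ?m x y \<le> ?\<kappa>"
    by (rule marginal_diff_le[OF l \<epsilon> Q inputs r r close' False[symmetric]])
  ultimately show ?thesis
    by linarith
qed

end

theorem lemma3: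
  fixes l \<epsilon> :: real
  assumes "0 \<le> l" and "l \<le> 1 / 4" and "0 \<le> \<epsilon>" and "\<epsilon> \<le> 1"
  shows "let \<kappa> = \<epsilon> + (1 - \<epsilon>) * ((1 - 4 * l) / (1 - 2 * l))
         in S_relaxed l \<epsilon> \<epsilon> \<subseteq> S_signaling \<kappa> \<kappa>"
  unfolding Let_def
proof
  fix p assume "p \<in> S_relaxed l \<epsilon> \<epsilon>"
  then obtain \<mu> Q and PA PB :: "bool \<Rightarrow> bool \<Rightarrow> nat \<Rightarrow> bool pmf" where
    p: "behavior p"
    and *: "\<forall>a b x y. p a b x y =
           (\<Sum>\<^sub>\<infinity>h. hidden_given_inputs \<mu> Q x y h * pmf (PA x y h) a * pmf (PB x y h) b)"
      "\<forall>x y h. l \<le> pmf (Q h) (x, y)"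
      "\<forall>x y. (\<Sum>\<^sub>\<infinity>h. pmf \<mu> h * pmf (Q h) (x, y)) = pmf input_dist (x, y)"
      "\<forall>b x x' y h. \<bar>pmf (PB x y h) b - pmf (PB x' y h) b\<bar> \<le> \<epsilon>"
      "\<forall>a x y y' h. \<bar>pmf (PA x y h) a - pmf (PA x y' h) a\<bar> \<le> \<epsilon>"
    unfolding S_relaxed_def mem_Collect_eq by (elim exE conjE) (rule that)
  note p_eq = *(1)[rule_format] and Q = *(2)[rule_format] and inputs = *(3)[rule_format]
    and PB = *(4)[rule_format] and PA = *(5)[rule_format]
  let ?\<kappa> = "\<epsilon> + (1 - \<epsilon>) * ((1 - 4 * l) / (1 - 2 * l))"
  note le = marginal_dist_le[OF assms Q inputs]
  have "\<bar>(\<Sum>a\<in>UNIV. p a b x y) - (\<Sum>a\<in>UNIV. p a b x' y)\<bar> \<le> ?\<kappa>" for b x x' y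
    unfolding p_eq marginal_eq
    by (rule le[where r = "\<lambda>x y h. pmf (PB x y h) b"]) (auto simp: PB pmf_le_1)
  moreover have "\<bar>(\<Sum>b\<in>UNIV. p a b x y) - (\<Sum>b\<in>UNIV. p a b x y')\<bar> \<le> ?\<kappa>" for a x y y'
    unfolding p_eq marginal_eq
    by (rule le[where r = "\<lambda>x y h. pmf (PA x y h) a"]) (auto simp: PA pmf_le_1)
  \<comment> \<open>A fresh model is required: in the given one the weights of the hidden values may
    depend on the inputs.\<close>
  moreover obtain \<mu>' :: "nat pmf" and PA' PB' :: "bool \<Rightarrow> bool \<Rightarrow> nat \<Rightarrow> bool pmf" where
    "\<And>a b x y. p a b x y = (\<Sum>\<^sub>\<infinity>h. pmf \<mu>' h * pmf (PA' x y h) a * pmf (PB' x y h) b)"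
    using p by (rule behavior_hidden_variable_form) blast
  ultimately show "p \<in> S_signaling ?\<kappa> ?\<kappa>"
    unfolding S_signaling_def using p by blast
qed

end
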